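(* A sequence of order $2$ with terms from $\{\mathtt{A^*},\mathtt{A^+},\mathtt{A^-},\mathtt{N},\mathtt{S^*},\mathtt{S^+},\mathtt{S^-}\}$ does not occur as a subsequence of the sepr-sequence of any Hermitian matrix if and only if it is one of the following sequences: $\mathtt{A^*N}$, $\mathtt{NA^*}$, $\mathtt{NS^*}$, $\mathtt{S^*N}$.
   Context: Let $B \in \mathbb{C}^{n\times n}$ be Hermitian ($n$ any positive integer). For $\alpha\subseteq\{1,\dots,n\}$ with $|\alpha|=k\ge 1$, the determinant of the submatrix $B[\alpha]$ lying in the rows and columns indexed by $\alpha$ is a principal minor of order $k$ (it is a real number). The signed enhanced principal rank characteristic sequence (sepr-sequence) of $B$ is $\operatorname{sepr}(B)=t_1t_2\cdots t_n$, where each $t_k$ is one of the seven symbols $\mathtt{A^*},\mathtt{A^+},\mathtt{A^-},\mathtt{N},\mathtt{S^*},\mathtt{S^+},\mathtt{S^-}$, determined as follows: - $t_k=\mathtt{A^*}$ if all order-$k$ principal minors of $B$ are nonzero and there are both positive and negative ones; - $t_k=\mathtt{A^+}$ (respectively $\mathtt{A^-}$) if all order-$k$ principal minors of $B$ are positive (respectively negative); - $t_k=\mathtt{N}$ if all order-$k$ principal minors of $B$ are zero; - $t_k=\mathtt{S^*}$ if $B$ has a positive, a negative and a zero order-$k$ principal minor; - $t_k=\mathtt{S^+}$ (respectively $\mathtt{S^-}$) if $B$ has both a zero and a nonzero order-$k$ principal minor and all nonzero order-$k$ principal minors are positive (respectively negative). The order of a sequence is its number of terms. A subsequence of $x_1x_2\cdots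 x_n$ means a block of consecutive terms $x_px_{p+1}\cdots x_q$ with $1\le p\le q\le n$. *)

theory Defs
  imports
    "Jordan_Normal_Form.Schur_Decomposition"
    "Jordan_Normal_Form.DL_Submatrix"
    "HOL-Library.Sublist"
begin

definition hermitian_mat :: "complex mat \<Rightarrow> bool" where
  "hermitian_mat B \<longleftrightarrow> square_mat B \<and> mat_adjoint B = B"

text \<open>Rows and columns are indexed from 0. Principal minors of a Hermitian matrix are real
  (lemma \<open>det_principal_submatrix_real\<close> below), so taking the real part loses nothing.\<close>

definition principal_minors :: "complex mat \<Rightarrow> nat \<Rightarrow> real set" where
  "principal_minors B k =
     {Re (det (submatrix B \<alpha> \<alpha>)) | \<alpha>. \<alpha> \<subseteq> {..<dim_row B} \<and> card \<alpha> = k}"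

datatype sepr_symbol = A_star | A_plus | A_minus | N | S_star | S_plus | S_minus

fun sepr_symbol_of :: "real set \<Rightarrow> sepr_symbol \<Rightarrow> bool" where
  "sepr_symbol_of M A_star \<longleftrightarrow> (\<forall>m\<in>M. m \<noteq> 0) \<and> (\<exists>m\<in>M. m > 0) \<and> (\<exists>m\<in>M. m < 0)"
| "sepr_symbol_of M A_plus \<longleftrightarrow> (\<forall>m\<in>M. m > 0)"
| "sepr_symbol_of M A_minus \<longleftrightarrow> (\<forall>m\<in>M. m < 0)"
| "sepr_symbol_of M N \<longleftrightarrow> (\<forall>m\<in>M. m = 0)"
| "sepr_symbol_of M S_star \<longleftrightarrow> (\<exists>m\<in>M. m > 0) \<and> (\<exists>m\<in>M. m < 0) \<and> (\<exists>m\<in>M. m = 0)"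
| "sepr_symbol_of M S_plus \<longleftrightarrow>
     (\<exists>m\<in>M. m = 0) \<and> (\<exists>m\<in>M. m \<noteq> 0) \<and> (\<forall>m\<in>M. m \<noteq> 0 \<longrightarrow> m > 0)"
| "sepr_symbol_of M S_minus \<longleftrightarrow>
     (\<exists>m\<in>M. m = 0) \<and> (\<exists>m\<in>M. m \<noteq> 0) \<and> (\<forall>m\<in>M. m \<noteq> 0 \<longrightarrow> m < 0)"

text \<open>For \<open>1 \<le> k \<le> n\<close> the set of principal minors of order \<open>k\<close> is nonempty, and then exactly one
  symbol applies (lemmas \<open>principal_minors_nonempty\<close>, \<open>sepr_symbol_unique\<close> below).\<close>

definition sepr_term :: "complex mat \<Rightarrow> nat \<Rightarrow> sepr_symbol" where
  "sepr_term B k = (THE s. sepr_symbol_of (principal_minors B k) s)"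

definition sepr :: "complex mat \<Rightarrow> sepr_symbol list" where
  "sepr B = map (sepr_term B) [1..<dim_row B + 1]"

lemma principal_minors_nonempty:
  assumes "k \<le> dim_row B"
  shows "principal_minors B k \<noteq> {}"
proof -
  have "{..<k} \<subseteq> {..<dim_row B} \<and> card {..<k} = k" using assms by auto
  then show ?thesis unfolding principal_minors_def by blast
qed

lemma sepr_symbol_unique:
  assumes "M \<noteq> {}"
  shows "\<exists>!s. sepr_symbol_of M s"
proof -
  define P where "P \<longleftrightarrow> (\<exists>m\<in>M. m > 0)"
  define Q where "Q \<longleftrightarrow> (\<exists>m\<in>M. m < 0)"
  define Z where "Z \<longleftrightarrow> (\<exists>m\<in>M. m = 0)"
  have tri: "(m > 0 \<and> \<not> m < 0 \<and> m \<noteq> 0) \<or> (\<not> m > 0 \<and> m < 0 \<and> m \<noteq> 0) \<or>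
      (\<not> m > 0 \<and> \<not> m < 0 \<and> m = 0)" for m :: real
    by linarith
  have all: "(\<forall>m\<in>M. m \<noteq> 0) \<longleftrightarrow> \<not> Z" "(\<forall>m\<in>M. m > 0) \<longleftrightarrow> \<not> Q \<and> \<not> Z"
      "(\<forall>m\<in>M. m < 0) \<longleftrightarrow> \<not> P \<and> \<not> Z" "(\<forall>m\<in>M. m = 0) \<longleftrightarrow> \<not> P \<and> \<not> Q"
      "(\<exists>m\<in>M. m \<noteq> 0) \<longleftrightarrow> P \<or> Q" "(\<forall>m\<in>M. m \<noteq> 0 \<longrightarrow> m > 0) \<longleftrightarrow> \<not> Q"
      "(\<forall>m\<in>M. m \<noteq> 0 \<longrightarrow> m < 0) \<longleftrightarrow> \<not> P"
    unfolding P_def Q_def Z_def using tri by blast+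
  have any: "P \<or> Q \<or> Z"
    using assms tri unfolding P_def Q_def Z_def by blast
  have eqs: "sepr_symbol_of M A_star \<longleftrightarrow> \<not> Z \<and> P \<and> Q"
      "sepr_symbol_of M A_plus \<longleftrightarrow> \<not> Q \<and> \<not> Z"
      "sepr_symbol_of M A_minus \<longleftrightarrow> \<not> P \<and> \<not> Z"
      "sepr_symbol_of M N \<longleftrightarrow> \<not> P \<and> \<not> Q"
      "sepr_symbol_of M S_star \<longleftrightarrow> P \<and> Q \<and> Z"
      "sepr_symbol_of M S_plus \<longleftrightarrow> Z \<and> (P \<or> Q) \<and> \<not> Q"
      "sepr_symbol_of M S_minus \<longleftrightarrow> Z \<and> (P \<or> Q) \<and> \<not> P"
    unfolding sepr_symbol_of.simps all by (simp_all only: P_def Q_def Z_def)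
  show ?thesis
  proof (rule ex_ex1I)
    show "\<exists>s. sepr_symbol_of M s"
      using any eqs by blast
  next
    fix s t
    assume "sepr_symbol_of M s" "sepr_symbol_of M t"
    then show "s = t"
      using any by (cases s; cases t) (simp_all only: eqs, blast+)
  qed
qed

lemma sepr_term_eq_iff:
  assumes "k \<le> dim_row B"
  shows "sepr_term B k = s \<longleftrightarrow> sepr_symbol_of (principal_minors B k) s"
  unfolding sepr_term_def
  using theI'[OF sepr_symbol_unique[OF principal_minors_nonempty[OF assms]]]
    sepr_symbol_unique[OF principal_minors_nonempty[OF assms]]
  by blast

lemma length_sepr [simp]: "length (sepr B) = dim_row B"
  by (simp add: sepr_def)

lemma hermitian_mat_index:
  assumes "hermitian_mat B" "i < dim_row B" "j < dim_row B"
  shows "B $$ (i, j) = cnj (B $$ (j, i))"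
proof -
  have "B $$ (i, j) = mat_adjoint B $$ (i, j)" and "dim_col B = dim_row B"
    using assms(1) by (auto simp: hermitian_mat_def)
  then show ?thesis
    using assms(2,3) by (simp add: mat_adjoint_def mat_of_rows_def)
qed

lemma det_principal_submatrix_real:
  assumes "hermitian_mat B"
  shows "det (submatrix B \<alpha> \<alpha>) \<in> \<real>"
proof -
  interpret cnj: comm_ring_hom cnj by unfold_locales auto
  let ?S = "submatrix B \<alpha> \<alpha>"
  have sq: "dim_col B = dim_row B" using assms by (simp add: hermitian_mat_def)
  have S: "?S \<in> carrier_mat (dim_row ?S) (dim_row ?S)"
    by (auto simp: dim_submatrix sq)
  have pick: "pick \<alpha> i < dim_row B" if "i < card {a. a < dim_row B \<and> a \<in> \<alpha>}" for i
    using that by (rule pick_le)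
  have "map_mat cnj ?S = transpose_mat ?S"
    by (rule eq_matI)
       (auto simp: dim_submatrix sq submatrix_index pick
             intro!: hermitian_mat_index[OF assms, symmetric])
  then have "cnj (det ?S) = det ?S"
    using det_transpose[OF S] cnj.hom_det[of ?S] by simp
  then show ?thesis by (simp add: Reals_cnj_iff)
qed

end

theory Submission
  imports Defs
begin

text \<open>
  The excluded pairs are those in which \<open>N\<close> is adjacent, on either side, to a term with minors of both
  signs. Why they cannot occur: for a Hermitian \<open>B\<close> and a real diagonal \<open>D\<close> the polynomial
  \<open>det (x I + D B D)\<close> has only real roots, and its coefficients are the sums of the principal minors of
  \<open>D B D\<close> of each order. The minor on \<open>\<alpha>\<close> of \<open>D B D\<close> is that of \<open>B\<close> times a square, so an order with
  only zero minors stays such under every \<open>D\<close>, while for an order with minors of both signs the sum can be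
  made 0 by moving \<open>D\<close> continuously from a set with a positive minor to one with a negative minor. Two
  adjacent coefficients then vanish. In a real-rooted polynomial this forces a root of high order at 0
  (\<open>real_rooted_consecutive_zero_coeffs\<close>), and for a Hermitian matrix a root of high order means low
  rank, so that individual minors vanish and not only their sums (\<open>pminor_eq_0_if_minor_sums_0\<close>). This
  contradicts the choice of the sets (\<open>same_sign_if_adjacent_order_0\<close>).

  The 45 other pairs occur already as the terms of orders 2 and 3 of a symmetric integer matrix of size 4,
  listed in the table \<open>witnesses\<close>.
\<close>

section \<open>Principal minors and the coefficients of det (x I + A)\<close>

text \<open>The Leibniz sum of the principal minor on \<open>\<alpha>\<close>, with the original row and column numbers kept, so
that minors of different matrices and of different index sets can be compared without renumbering.\<close>

definition pminor :: "'a::comm_ring_1 mat \<Rightarrow> nat set \<Rightarrow> 'a" where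
  "pminor A \<alpha> = (\<Sum>p | p permutes \<alpha>. of_int (sign p) * (\<Prod>i\<in>\<alpha>. A $$ (i, p i)))"

lemma bij_betw_pick:
  assumes "finite \<alpha>"
  shows "bij_betw (pick \<alpha>) {0..<card \<alpha>} \<alpha>"
proof -
  have inj: "inj_on (pick \<alpha>) {0..<card \<alpha>}"
  proof (rule inj_onI)
    fix x y assume "x \<in> {0..<card \<alpha>}" "y \<in> {0..<card \<alpha>}" "pick \<alpha> x = pick \<alpha> y"
    then show "x = y"
      by (metis atLeastLessThan_iff nat_neq_iff pick_mono_le)
  qed
  have "pick \<alpha> ` {0..<card \<alpha>} \<subseteq> \<alpha>"
    by (auto intro: pick_in_set_le)
  moreover have "card (pick \<alpha> ` {0..<card \<alpha>}) = card \<alpha>"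
    using inj by (simp add: card_image)
  ultimately have "pick \<alpha> ` {0..<card \<alpha>} = \<alpha>"
    using assms by (metis card_subset_eq)
  with inj show ?thesis by (simp add: bij_betw_def)
qed

text \<open>\<^term>\<open>submatrix\<close> renumbers the indices in \<open>\<alpha>\<close> by \<^term>\<open>pick\<close>. Conjugating by this renumbering carries the
permutations of \<open>{0..<card \<alpha>}\<close> to those of \<open>\<alpha>\<close> and keeps signs, so the two Leibniz sums agree
term by term.\<close>

lemma det_submatrix_eq_pminor:
  assumes "A \<in> carrier_mat n n" "\<alpha> \<subseteq> {..<n}"
  shows "det (submatrix A \<alpha> \<alpha>) = pminor A \<alpha>"
proof -
  define k where "k = card \<alpha>"
  define f where "f = pick \<alpha>"
  have fin: "finite \<alpha>" using assms(2) finite_subset by blast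
  have bij: "bij_betw f {0..<k} \<alpha>"
    unfolding f_def k_def using bij_betw_pick[OF fin] .
  then have inj: "inj_on f {0..<k}" and img: "f ` {0..<k} = \<alpha>"
    by (auto simp: bij_betw_def)
  have \<alpha>: "{i. i < n \<and> i \<in> \<alpha>} = \<alpha>" using assms(2) by auto
  have sub: "submatrix A \<alpha> \<alpha> = mat k k (\<lambda>(i, j). A $$ (f i, f j))"
    using assms(1) by (simp add: submatrix_def \<alpha> f_def k_def)
  let ?M = "map_permutation {0..<k} f"
  let ?g = "\<lambda>p. of_int (sign p) * (\<Prod>i\<in>\<alpha>. A $$ (i, p i))"
  have M_bij: "bij_betw ?M {p. p permutes {0..<k}} {p. p permutes \<alpha>}"
  proof (rule bij_betw_byWitness[where f' = "map_permutation \<alpha> (inv_into {0..<k} f)"])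
    show "\<forall>p\<in>{p. p permutes {0..<k}}. map_permutation \<alpha> (inv_into {0..<k} f) (?M p) = p"
      using bij inj by (auto intro!: map_permutation_compose_inv)
    show "\<forall>p\<in>{p. p permutes \<alpha>}. ?M (map_permutation \<alpha> (inv_into {0..<k} f) p) = p"
      using bij_betw_inv_into[OF bij] img
      by (auto intro!: map_permutation_compose_inv simp: f_inv_into_f)
    show "?M ` {p. p permutes {0..<k}} \<subseteq> {p. p permutes \<alpha>}"
      using map_permutation_permutes[OF bij] by auto
    show "map_permutation \<alpha> (inv_into {0..<k} f) ` {p. p permutes \<alpha>} \<subseteq> {p. p permutes {0..<k}}"
      using map_permutation_permutes[OF bij_betw_inv_into[OF bij]] by auto
  qed
  have "pminor A \<alpha> = (\<Sum>p | p permutes {0..<k}. ?g (?M p))"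
    unfolding pminor_def using sum.reindex_bij_betw[OF M_bij, of ?g] by simp
  also have "\<dots> = (\<Sum>p | p permutes {0..<k}. of_int (sign p) *
      (\<Prod>i = 0..<k. A $$ (f i, f (p i))))"
  proof (rule sum.cong[OF refl])
    fix p assume "p \<in> {p. p permutes {0..<k}}"
    then have p: "p permutes {0..<k}" by simp
    have "(\<Prod>i\<in>\<alpha>. A $$ (i, ?M p i)) = (\<Prod>i = 0..<k. A $$ (f i, ?M p (f i)))"
      using prod.reindex_bij_betw[OF bij, of "\<lambda>i. A $$ (i, ?M p i)"] by simp
    also have "\<dots> = (\<Prod>i = 0..<k. A $$ (f i, f (p i)))"
      by (rule prod.cong[OF refl]) (simp add: map_permutation_apply[OF inj])
    finally show "?g (?M p) = of_int (sign p) * (\<Prod>i = 0..<k. A $$ (f i, f (p i)))"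
      using sign_map_permutation[OF inj p] by simp
  qed
  also have "\<dots> = det (submatrix A \<alpha> \<alpha>)"
    unfolding sub det_def
    by (auto intro!: sum.cong prod.cong simp: permutes_in_image dest: permutes_in_image)
  finally show ?thesis by simp
qed

text \<open>Expanding each Leibniz product of \<open>x I + A\<close> over the set \<open>\<alpha>\<close> of rows from which the entry of \<open>A\<close> is
taken forces the permutation to fix every row outside \<open>\<alpha>\<close>; what remains is a Leibniz sum over the
permutations of \<open>\<alpha>\<close>.\<close>

lemma det_add_scalar_mat:
  assumes A: "A \<in> carrier_mat n n"
  shows "det (x \<cdot>\<^sub>m 1\<^sub>m n + A) = (\<Sum>\<alpha>\<in>Pow {..<n}. x ^ (n - card \<alpha>) * pminor A \<alpha>)"
proof -
  let ?N = "{..<n}"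
  let ?g = "\<lambda>p i. if p i = i then x else 0"
  let ?t = "\<lambda>p \<alpha>. of_int (sign p) * ((\<Prod>i\<in>\<alpha>. A $$ (i, p i)) * (\<Prod>i\<in>?N - \<alpha>. ?g p i))"
  have "det (x \<cdot>\<^sub>m 1\<^sub>m n + A) =
      (\<Sum>p | p permutes ?N. of_int (sign p) * (\<Prod>i\<in>?N. A $$ (i, p i) + ?g p i))"
  proof -
    have car: "x \<cdot>\<^sub>m 1\<^sub>m n + A \<in> carrier_mat n n" using A by simp
    have "(\<Prod>i<n. (x \<cdot>\<^sub>m 1\<^sub>m n + A) $$ (i, p i)) = (\<Prod>i<n. A $$ (i, p i) + ?g p i)"
      if p: "p permutes ?N" for p
    proof (rule prod.cong[OF refl])
      fix i assume "i \<in> ?N"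
      moreover from this have "p i < n" using p permutes_in_image by fastforce
      ultimately show "(x \<cdot>\<^sub>m 1\<^sub>m n + A) $$ (i, p i) = A $$ (i, p i) + ?g p i"
        using A by auto
    qed
    then show ?thesis
      unfolding det_def'[OF car] by (auto simp: atLeast0LessThan intro!: sum.cong)
  qed
  also have "\<dots> = (\<Sum>p | p permutes ?N. \<Sum>\<alpha>\<in>Pow ?N. ?t p \<alpha>)"
    by (simp add: prod_add sum_distrib_left)
  also have "\<dots> = (\<Sum>\<alpha>\<in>Pow ?N. \<Sum>p | p permutes ?N. ?t p \<alpha>)"
    by (rule sum.swap)
  also have "\<dots> = (\<Sum>\<alpha>\<in>Pow ?N. x ^ (n - card \<alpha>) * pminor A \<alpha>)"
  proof (rule sum.cong[OF refl])
    fix \<alpha> assume "\<alpha> \<in> Pow ?N"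
    then have \<alpha>: "\<alpha> \<subseteq> ?N" by simp
    have "(\<Sum>p | p permutes ?N. ?t p \<alpha>) = (\<Sum>p | p permutes \<alpha>. ?t p \<alpha>)"
    proof (rule sum.mono_neutral_right)
      show "finite {p. p permutes ?N}" by (rule finite_permutations) simp
      show "{p. p permutes \<alpha>} \<subseteq> {p. p permutes ?N}"
        using \<alpha> permutes_subset by blast
      show "\<forall>p\<in>{p. p permutes ?N} - {p. p permutes \<alpha>}. ?t p \<alpha> = 0"
      proof
        fix p assume p: "p \<in> {p. p permutes ?N} - {p. p permutes \<alpha>}"
        then obtain i where "i \<in> ?N - \<alpha>" "p i \<noteq> i"
          using permutes_superset[of p ?N \<alpha>] by auto
        then have "(\<Prod>i\<in>?N - \<alpha>. ?g p i) = 0"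
          by (intro prod_zero) auto
        then show "?t p \<alpha> = 0" by simp
      qed
    qed
    also have "\<dots> = (\<Sum>p | p permutes \<alpha>. x ^ (n - card \<alpha>) *
        (of_int (sign p) * (\<Prod>i\<in>\<alpha>. A $$ (i, p i))))"
    proof (rule sum.cong[OF refl])
      fix p assume "p \<in> {p. p permutes \<alpha>}"
      then have "(\<Prod>i\<in>?N - \<alpha>. ?g p i) = (\<Prod>i\<in>?N - \<alpha>. x)"
        by (intro prod.cong) (auto simp: permutes_not_in)
      also have "\<dots> = x ^ (n - card \<alpha>)"
        using \<alpha> by (simp add: card_Diff_subset finite_subset)
      finally show "?t p \<alpha> = x ^ (n - card \<alpha>) *
          (of_int (sign p) * (\<Prod>i\<in>\<alpha>. A $$ (i, p i)))"
        by (simp add: ac_simps)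
    qed
    finally show "(\<Sum>p | p permutes ?N. ?t p \<alpha>) = x ^ (n - card \<alpha>) * pminor A \<alpha>"
      by (simp add: pminor_def sum_distrib_left)
  qed
  finally show ?thesis .
qed

section \<open>Real-rooted polynomials\<close>

definition real_rooted :: "complex poly \<Rightarrow> bool" where
  "real_rooted p \<longleftrightarrow> (\<forall>z. poly p z = 0 \<longrightarrow> z \<in> \<real>)"

lemma poly_pderiv_prod_linear:
  fixes z :: complex
  assumes "z \<notin> set as"
  shows "poly (pderiv (\<Prod>a\<leftarrow>as. [:- a, 1:])) z =
      poly (\<Prod>a\<leftarrow>as. [:- a, 1:]) z * (\<Sum>a\<leftarrow>as. 1 / (z - a))"
  using assms
proof (induction as)
  case (Cons a as)
  then have "z - a \<noteq> 0" by auto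
  define P where "P = (\<Prod>a\<leftarrow>as. [:- a, 1:])"
  have IH: "poly (pderiv P) z = poly P z * (\<Sum>a\<leftarrow>as. 1 / (z - a))"
    using Cons unfolding P_def by simp
  have "poly (pderiv ([:- a, 1:] * P)) z = poly P z + (z - a) * poly (pderiv P) z"
    unfolding pderiv_mult by (simp add: pderiv_pCons left_diff_distrib)
  also have "\<dots> = poly P z + (z - a) * poly P z * (\<Sum>a\<leftarrow>as. 1 / (z - a))"
    unfolding IH by simp
  also have "\<dots> = (z - a) * poly P z * (1 / (z - a) + (\<Sum>a\<leftarrow>as. 1 / (z - a)))"
    using \<open>z - a \<noteq> 0\<close> by (simp add: distrib_left)
  finally show ?case by (simp add: P_def algebra_simps)
qed simp

lemma real_rooted_factorization:
  assumes "real_rooted p"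
  obtains as where "p = smult (lead_coeff p) (\<Prod>a\<leftarrow>as. [:- a, 1:])"
    "length as = degree p" "set as \<subseteq> \<real>"
proof -
  obtain as where as: "smult (lead_coeff p) (\<Prod>a\<leftarrow>as. [:- a, 1:]) = p" "length as = degree p"
    using fundamental_theorem_algebra_factorized by blast
  have "set as \<subseteq> \<real>"
  proof
    fix a assume "a \<in> set as"
    then have "poly (\<Prod>a\<leftarrow>as. [:- a, 1:]) a = 0"
      by (induction as) auto
    then have "poly p a = 0"
      by (subst as(1)[symmetric]) simp
    then show "a \<in> \<real>" using assms by (simp add: real_rooted_def)
  qed
  then show ?thesis using as that by metis
qed

text \<open>Each \<open>1 / (z - a)\<close> with real \<open>a\<close> lies in the half plane opposite to that of \<open>z\<close>, hence so does the sum.\<close>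

lemma Im_sum_inverse_linear:
  fixes z :: complex
  assumes "set as \<subseteq> \<real>" "as \<noteq> []" "Im z \<noteq> 0"
  shows "Im z * Im (\<Sum>a\<leftarrow>as. 1 / (z - a)) < 0"
proof -
  have summand: "Im z * Im (1 / (z - a)) < 0" if "a \<in> \<real>" for a
  proof -
    have "Im (1 / (z - a)) = - Im z / (cmod (z - a))\<^sup>2"
      using that by (auto simp: Im_divide cmod_power2 complex_is_Real_iff)
    moreover have "0 < (cmod (z - a))\<^sup>2"
      using that assms(3) by (auto simp: complex_is_Real_iff)
    moreover have "0 < Im z * Im z" using assms(3) by (auto simp: zero_less_mult_iff)
    ultimately show ?thesis by (simp add: divide_neg_pos)
  qed
  show ?thesis
    using assms(1,2)
  proof (induction as)
    case (Cons a as)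
    show ?case
      using Cons summand[of a] by (cases "as = []") (auto simp: distrib_left)
  qed simp
qed

text \<open>At a nonreal point the logarithmic derivative has nonzero imaginary part, so the derivative has no
nonreal root. This is the Gauss--Lucas argument for the real line.\<close>

lemma real_rooted_pderiv:
  assumes "real_rooted p" "degree p \<ge> 1"
  shows "real_rooted (pderiv p)"
  unfolding real_rooted_def
proof (intro allI impI, rule ccontr)
  fix z assume z: "poly (pderiv p) z = 0" "z \<notin> \<real>"
  obtain as where as: "p = smult (lead_coeff p) (\<Prod>a\<leftarrow>as. [:- a, 1:])"
      "length as = degree p" "set as \<subseteq> \<real>"
    using real_rooted_factorization[OF assms(1)] by metis
  have "poly (pderiv p) z = poly p z * (\<Sum>a\<leftarrow>as. 1 / (z - a))"
    using poly_pderiv_prod_linear[of z as] z(2) as(3)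
    by (subst (1 2) as(1)) (auto simp: pderiv_smult)
  moreover have "poly p z \<noteq> 0"
    using assms(1) z(2) by (auto simp: real_rooted_def)
  ultimately have "(\<Sum>a\<leftarrow>as. 1 / (z - a)) = 0" using z(1) by simp
  moreover have "as \<noteq> []" using as(2) assms(2) by auto
  moreover have "Im z \<noteq> 0" using z(2) by (simp add: complex_is_Real_iff)
  ultimately show False using Im_sum_inverse_linear[OF as(3), of z] by simp
qed

text \<open>Newton's identity for the sum of the squares of the reciprocal roots. If there is a
root and all of them are real, then the right-hand side cannot vanish, which excludes \<open>coeff p 1 = coeff p 2 = 0\<close>.\<close>

lemma low_coeffs_prod_linear:
  fixes as :: "complex list"
  assumes "0 \<notin> set as"
  defines "p \<equiv> \<Prod>a\<leftarrow>as. [:- a, 1:]"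
  shows "(coeff p 1)\<^sup>2 - 2 * coeff p 0 * coeff p 2 = (coeff p 0)\<^sup>2 * (\<Sum>a\<leftarrow>as. 1 / a\<^sup>2)"
  using assms(1) unfolding p_def
proof (induction as)
  case (Cons a as)
  define q where "q = (\<Prod>a\<leftarrow>as. [:- a, 1:])"
  have IH: "(coeff q 1)\<^sup>2 - 2 * coeff q 0 * coeff q 2 = (coeff q 0)\<^sup>2 * (\<Sum>a\<leftarrow>as. 1 / a\<^sup>2)"
    using Cons unfolding q_def by simp
  have c: "coeff ([:- a, 1:] * q) 0 = - a * coeff q 0"
      "coeff ([:- a, 1:] * q) 1 = coeff q 0 - a * coeff q 1"
      "coeff ([:- a, 1:] * q) 2 = coeff q 1 - a * coeff q 2"
    by (simp_all add: coeff_pCons numeral_2_eq_2)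
  have "(coeff ([:- a, 1:] * q) 1)\<^sup>2 - 2 * coeff ([:- a, 1:] * q) 0 * coeff ([:- a, 1:] * q) 2 =
      (coeff q 0)\<^sup>2 + a\<^sup>2 * ((coeff q 1)\<^sup>2 - 2 * coeff q 0 * coeff q 2)"
    unfolding c by (simp add: power2_eq_square algebra_simps)
  also have "\<dots> = (coeff ([:- a, 1:] * q) 0)\<^sup>2 * (1 / a\<^sup>2 + (\<Sum>a\<leftarrow>as. 1 / a\<^sup>2))"
    unfolding IH c using Cons.prems by (simp add: field_simps power_mult_distrib)
  finally show ?case by (simp add: q_def)
qed (simp add: numeral_2_eq_2)

lemma real_rooted_coeff_0_eq_0:
  assumes "real_rooted p" "degree p \<ge> 1" "coeff p 1 = 0" "coeff p 2 = 0"
  shows "coeff p 0 = 0"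
proof (rule ccontr)
  assume c0: "coeff p 0 \<noteq> 0"
  have p0: "p \<noteq> 0" using assms(2) by auto
  obtain as where as: "p = smult (lead_coeff p) (\<Prod>a\<leftarrow>as. [:- a, 1:])"
      "length as = degree p" "set as \<subseteq> \<real>"
    using real_rooted_factorization[OF assms(1)] by metis
  define q where "q = (\<Prod>a\<leftarrow>as. [:- a, 1:])"
  have q: "coeff q 1 = 0" "coeff q 2 = 0" "coeff q 0 \<noteq> 0"
  proof -
    have "coeff p i = lead_coeff p * coeff q i" for i
      by (subst as(1)) (simp add: q_def)
    then show "coeff q 1 = 0" "coeff q 2 = 0" "coeff q 0 \<noteq> 0"
      using assms(3,4) c0 p0 by (metis leading_coeff_0_iff mult_eq_0_iff)+
  qed
  have nz: "0 \<notin> set as"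
  proof
    assume "0 \<in> set as"
    then have "poly q 0 = 0" unfolding q_def by (induction as) auto
    then show False using q(3) by (simp add: poly_0_coeff_0)
  qed
  have "(\<Sum>a\<leftarrow>as. 1 / a\<^sup>2) = 0"
    using low_coeffs_prod_linear[OF nz] q unfolding q_def[symmetric] by simp
  moreover have "Re (\<Sum>a\<leftarrow>as. 1 / a\<^sup>2) > 0"
  proof -
    have pos: "Re (1 / a\<^sup>2) > 0" if "a \<in> \<real>" "a \<noteq> 0" for a :: complex
      using that by (auto simp: Reals_def power2_eq_square zero_less_mult_iff simp flip: of_real_mult)
    have "as \<noteq> []" using as(2) assms(2) by auto
    then show ?thesis
      using as(3) nz
    proof (induction as)
      case (Cons a as)
      show ?case using Cons pos[of a] by (cases "as = []") (auto intro: add_pos_pos)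
    qed simp
  qed
  ultimately show False by simp
qed

text \<open>Derivatives stay real-rooted, and differentiation shifts a pair of vanishing coefficients down until
it sits at positions 1 and 2, where it forces the constant term to vanish.
The bound \<open>Suc j \<le> degree p\<close> excludes pairs of zeros beyond the leading coefficient.\<close>

lemma real_rooted_consecutive_zero_coeffs:
  assumes "real_rooted p" "coeff p j = 0" "coeff p (Suc j) = 0" "Suc j \<le> degree p" "i \<le> Suc j"
  shows "coeff p i = 0"
  using assms
proof (induction j arbitrary: p i)
  case 0
  then show ?case by (cases i) auto
next
  case (Suc j)
  have deriv: "coeff (pderiv p) i = 0" if "i \<le> Suc j" for i
  proof (rule Suc.IH)
    show "real_rooted (pderiv p)"
      using Suc.prems by (intro real_rooted_pderiv) auto
  qed (use Suc.prems that in \<open>auto simp: coeff_pderiv degree_pderiv\<close>)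
  have pos: "coeff p i = 0" if "1 \<le> i" "i \<le> Suc (Suc j)" for i
    using deriv[of "i - 1"] that by (cases i) (auto simp: coeff_pderiv simp del: of_nat_Suc)
  moreover have "coeff p 0 = 0"
    using Suc.prems pos[of 1] pos[of 2] by (auto intro!: real_rooted_coeff_0_eq_0)
  ultimately show ?case using Suc.prems(5) by (cases i) auto
qed

text \<open>The order of vanishing at 0 can be read off along any ray through 0; the positive imaginary axis is the
one on which Hermitian resolvents are controlled.\<close>

lemma monom_dvd_if_norm_le:
  fixes p q :: "complex poly"
  assumes "\<And>\<epsilon>. \<epsilon> > 0 \<Longrightarrow> cmod (poly q (\<i> * of_real \<epsilon>)) \<le> cmod (poly p (\<i> * of_real \<epsilon>))"
    and "monom 1 m dvd p"
  shows "monom 1 m dvd q"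
  using assms(2)
proof (induction m)
  case 0
  then show ?case by (simp add: monom_0 flip: one_pCons)
next
  case (Suc m)
  obtain p1 where p1: "p = monom 1 (Suc m) * p1" using Suc.prems by auto
  have "monom 1 m dvd p"
    using Suc.prems by (simp add: monom_1_dvd_iff')
  then obtain q1 where q1: "q = monom 1 m * q1" using Suc.IH by auto
  let ?z = "\<lambda>\<epsilon>::real. \<i> * of_real \<epsilon>"
  have le: "cmod (poly q1 (?z \<epsilon>)) \<le> \<epsilon> * cmod (poly p1 (?z \<epsilon>))" if "\<epsilon> > 0" for \<epsilon>
  proof -
    have "\<epsilon> ^ m * cmod (poly q1 (?z \<epsilon>)) \<le> \<epsilon> ^ m * (\<epsilon> * cmod (poly p1 (?z \<epsilon>)))"
      using assms(1)[OF that] that unfolding p1 q1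
      by (simp add: poly_monom norm_mult norm_power mult_ac)
    then show ?thesis using that by simp
  qed
  have z0: "(?z \<longlongrightarrow> 0) (at_right 0)"
    by (auto intro!: tendsto_eq_intros)
  have "((\<lambda>\<epsilon>. poly q1 (?z \<epsilon>)) \<longlongrightarrow> poly q1 0) (at_right 0)"
    by (intro tendsto_intros z0 isCont_tendsto_compose[OF poly_isCont])
  then have lim_q: "((\<lambda>\<epsilon>. cmod (poly q1 (?z \<epsilon>))) \<longlongrightarrow> cmod (poly q1 0)) (at_right 0)"
    by (rule tendsto_norm)
  have "((\<lambda>\<epsilon>. poly p1 (?z \<epsilon>)) \<longlongrightarrow> poly p1 0) (at_right 0)"
    by (intro tendsto_intros z0 isCont_tendsto_compose[OF poly_isCont])
  then have lim_p: "((\<lambda>\<epsilon>. \<epsilon> * cmod (poly p1 (?z \<epsilon>))) \<longlongrightarrow> 0 * cmod (poly p1 0)) (at_right 0)"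
    by (intro tendsto_mult tendsto_norm tendsto_ident_at)
  have "cmod (poly q1 0) \<le> 0 * cmod (poly p1 0)"
  proof (rule tendsto_le[OF _ lim_p lim_q])
    show "\<forall>\<^sub>F \<epsilon> in at_right 0. cmod (poly q1 (?z \<epsilon>)) \<le> \<epsilon> * cmod (poly p1 (?z \<epsilon>))"
      using le by (auto simp: eventually_at_right_field intro!: exI[of _ 1])
  qed simp
  then have "monom 1 1 dvd q1"
    by (simp add: monom_1_dvd_iff' poly_0_coeff_0)
  then have "monom 1 m * monom 1 1 dvd q"
    unfolding q1 by (rule mult_dvd_mono[OF dvd_refl])
  then show ?case by (simp add: mult_monom)
qed

section \<open>Hermitian matrices and their minor sums\<close>

definition minor_sum :: "'a::comm_ring_1 mat \<Rightarrow> nat \<Rightarrow> 'a" where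
  "minor_sum A k = (\<Sum>\<alpha> | \<alpha> \<subseteq> {..<dim_row A} \<and> card \<alpha> = k. pminor A \<alpha>)"

text \<open>The polynomial \<open>det (x I + A)\<close>, that is, the characteristic polynomial of \<open>-A\<close>. It is
given by its coefficients, because these are what the argument is about.\<close>

definition shift_poly :: "'a::comm_ring_1 mat \<Rightarrow> 'a poly" where
  "shift_poly A = (\<Sum>\<alpha>\<in>Pow {..<dim_row A}. monom (pminor A \<alpha>) (dim_row A - card \<alpha>))"

lemma poly_shift_poly:
  assumes "A \<in> carrier_mat n n"
  shows "poly (shift_poly A) x = det (x \<cdot>\<^sub>m 1\<^sub>m n + A)"
  using assms by (simp add: shift_poly_def det_add_scalar_mat poly_sum poly_monom mult.commute)

lemma coeff_shift_poly:
  assumes "A \<in> carrier_mat n n" "k \<le> n"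
  shows "coeff (shift_poly A) (n - k) = minor_sum A k"
proof -
  have card_le: "card \<alpha> \<le> n" if "\<alpha> \<subseteq> {..<n}" for \<alpha>
    using card_mono[OF _ that] by simp
  have "coeff (shift_poly A) (n - k) =
      (\<Sum>\<alpha>\<in>Pow {..<n}. if card \<alpha> = k then pminor A \<alpha> else 0)"
    unfolding shift_poly_def coeff_sum
  proof (intro sum.cong)
    fix \<alpha> assume "\<alpha> \<in> Pow {..<n}"
    then have "n - card \<alpha> = n - k \<longleftrightarrow> card \<alpha> = k"
      using card_le[of \<alpha>] assms(2) by auto
    then show "coeff (monom (pminor A \<alpha>) (dim_row A - card \<alpha>)) (n - k) =
        (if card \<alpha> = k then pminor A \<alpha> else 0)"
      using assms(1) by simp
  qed (use assms(1) in simp)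
  also have "\<dots> = (\<Sum>\<alpha>\<in>{\<alpha>\<in>Pow {..<n}. card \<alpha> = k}. pminor A \<alpha>)"
    by (rule sum.inter_filter[symmetric]) simp
  finally show ?thesis using assms by (simp add: minor_sum_def Pow_def)
qed

lemma degree_shift_poly:
  assumes "A \<in> carrier_mat n n"
  shows "degree (shift_poly A) = n"
proof (rule antisym)
  show "degree (shift_poly A) \<le> n"
    using assms unfolding shift_poly_def
    by (intro degree_sum_le) (auto intro: order_trans[OF degree_monom_le])
  have "{\<alpha>. \<alpha> \<subseteq> {..<n} \<and> card \<alpha> = 0} = {{}}"
    by (auto dest: finite_subset)
  then have "coeff (shift_poly A) n = 1"
    using coeff_shift_poly[OF assms, of 0] assms by (simp add: minor_sum_def pminor_def)
  then show "n \<le> degree (shift_poly A)" by (intro le_degree) simp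
qed

lemma hermitian_form_real:
  assumes "A \<in> carrier_mat n n" "hermitian_mat A"
  shows "Im (\<Sum>i<n. cnj (v i) * (\<Sum>j<n. A $$ (i, j) * v j)) = 0"
proof -
  let ?q = "\<Sum>i<n. \<Sum>j<n. cnj (v i) * (A $$ (i, j) * v j)"
  have A: "cnj (A $$ (i, j)) = A $$ (j, i)" if "i < n" "j < n" for i j
    using hermitian_mat_index[OF assms(2), of j i] assms(1) that by simp
  have "cnj ?q = (\<Sum>i<n. \<Sum>j<n. cnj (v j) * (A $$ (j, i) * v i))"
    by (simp add: A mult_ac)
  also have "\<dots> = ?q" by (rule sum.swap)
  finally have "?q \<in> \<real>" by (simp only: Reals_cnj_iff)
  then have "Im ?q = 0" by (simp only: complex_is_Real_iff)
  then show ?thesis by (simp add: sum_distrib_left)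
qed

text \<open>The quadratic form of \<open>A\<close> itself is real, so only \<open>z I\<close> contributes to the imaginary part. This identity gives
both the reality of the spectrum and the resolvent bound below.\<close>

lemma Im_hermitian_form_shifted:
  assumes A: "A \<in> carrier_mat n n" "hermitian_mat A" and v: "v \<in> carrier_vec n"
  shows "Im (\<Sum>i<n. cnj (v $ i) * ((z \<cdot>\<^sub>m 1\<^sub>m n + A) *\<^sub>v v) $ i) =
    Im z * (\<Sum>i<n. (cmod (v $ i))\<^sup>2)"
proof -
  have "((z \<cdot>\<^sub>m 1\<^sub>m n + A) *\<^sub>v v) $ i = z * v $ i + (\<Sum>j<n. A $$ (i, j) * v $ j)"
    if "i < n" for i
  proof -
    have "((z \<cdot>\<^sub>m 1\<^sub>m n + A) *\<^sub>v v) $ i =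
        (\<Sum>j<n. (z \<cdot>\<^sub>m 1\<^sub>m n + A) $$ (i, j) * v $ j)"
      using that A v by (auto simp: scalar_prod_def atLeast0LessThan intro!: sum.cong)
    also have "\<dots> = (\<Sum>j<n. (if j = i then z * v $ i else 0) + A $$ (i, j) * v $ j)"
      using that A by (intro sum.cong) (auto simp: distrib_right)
    finally show ?thesis using that by (simp add: sum.distrib)
  qed
  then have "(\<Sum>i<n. cnj (v $ i) * ((z \<cdot>\<^sub>m 1\<^sub>m n + A) *\<^sub>v v) $ i) =
      z * (\<Sum>i<n. cnj (v $ i) * v $ i) +
      (\<Sum>i<n. cnj (v $ i) * (\<Sum>j<n. A $$ (i, j) * v $ j))"
    by (simp add: distrib_left sum.distrib sum_distrib_left mult_ac)
  also have "(\<Sum>i<n. cnj (v $ i) * v $ i) = of_real (\<Sum>i<n. (cmod (v $ i))\<^sup>2)"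
    by (simp add: complex_norm_square mult.commute del: of_real_power)
  finally show ?thesis
    using hermitian_form_real[OF A, of "\<lambda>i. v $ i"] by simp
qed

text \<open>A kernel vector \<open>v\<close> of \<open>z I + A\<close> makes the left-hand side of the previous identity zero, so \<open>Im z = 0\<close>.\<close>

lemma real_rooted_shift_poly:
  assumes A: "A \<in> carrier_mat n n" "hermitian_mat A"
  shows "real_rooted (shift_poly A)"
  unfolding real_rooted_def
proof (intro allI impI)
  fix z assume "poly (shift_poly A) z = 0"
  then have "det (z \<cdot>\<^sub>m 1\<^sub>m n + A) = 0" using poly_shift_poly[OF A(1)] by simp
  then obtain v where v: "v \<in> carrier_vec n" "v \<noteq> 0\<^sub>v n" "(z \<cdot>\<^sub>m 1\<^sub>m n + A) *\<^sub>v v = 0\<^sub>v n"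
    using det_0_iff_vec_prod_zero[of "z \<cdot>\<^sub>m 1\<^sub>m n + A" n] A(1) by auto
  obtain i where "i < n" "v $ i \<noteq> 0"
    using v(1,2) by (auto simp: vec_eq_iff)
  then have "0 < (\<Sum>i<n. (cmod (v $ i))\<^sup>2)"
    by (intro sum_pos2[of _ i]) auto
  moreover have "Im z * (\<Sum>i<n. (cmod (v $ i))\<^sup>2) = 0"
    using Im_hermitian_form_shifted[OF A v(1), of z] v(3) by simp
  ultimately show "z \<in> \<real>" by (simp add: complex_is_Real_iff)
qed

text \<open>The congruence \<open>D A D\<close> with \<open>D = diag s\<close>. It keeps the matrix Hermitian and multiplies the
minor on \<open>\<alpha>\<close> by the square of \<open>\<Prod>i\<in>\<alpha>. s i\<close>. With an indicator function as \<open>s\<close> it erases rows and columns.\<close>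

definition scale_mat :: "(nat \<Rightarrow> real) \<Rightarrow> complex mat \<Rightarrow> complex mat" where
  "scale_mat s A = mat (dim_row A) (dim_col A) (\<lambda>(i, j). of_real (s i * s j) * A $$ (i, j))"

lemma scale_mat_carrier [simp]: "A \<in> carrier_mat n n \<Longrightarrow> scale_mat s A \<in> carrier_mat n n"
  by (simp add: scale_mat_def)

lemma hermitian_matI:
  assumes "A \<in> carrier_mat n n" "\<And>i j. i < n \<Longrightarrow> j < n \<Longrightarrow> A $$ (i, j) = cnj (A $$ (j, i))"
  shows "hermitian_mat A"
  using assms(1) unfolding hermitian_mat_def
  by (auto simp: mat_adjoint_def mat_of_rows_def assms(2)[symmetric] intro!: eq_matI)

lemma hermitian_scale_mat:
  assumes "A \<in> carrier_mat n n" "hermitian_mat A"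
  shows "hermitian_mat (scale_mat s A)"
proof (rule hermitian_matI)
  show "scale_mat s A \<in> carrier_mat n n" using assms by simp
  show "scale_mat s A $$ (i, j) = cnj (scale_mat s A $$ (j, i))" if "i < n" "j < n" for i j
    using assms(1) that hermitian_mat_index[OF assms(2), of i j] by (simp add: scale_mat_def)
qed

lemma pminor_scale_mat:
  assumes "A \<in> carrier_mat n n" "\<alpha> \<subseteq> {..<n}"
  shows "pminor (scale_mat s A) \<alpha> = of_real (\<Prod>i\<in>\<alpha>. (s i)\<^sup>2) * pminor A \<alpha>"
proof -
  have "(\<Prod>i\<in>\<alpha>. scale_mat s A $$ (i, p i)) =
      of_real (\<Prod>i\<in>\<alpha>. (s i)\<^sup>2) * (\<Prod>i\<in>\<alpha>. A $$ (i, p i))" if p: "p permutes \<alpha>" for p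
  proof -
    have "p i \<in> \<alpha>" if "i \<in> \<alpha>" for i using p that by (simp add: permutes_in_image)
    then have "(\<Prod>i\<in>\<alpha>. scale_mat s A $$ (i, p i)) =
        (\<Prod>i\<in>\<alpha>. of_real (s i * s (p i)) * A $$ (i, p i))"
      using assms by (intro prod.cong) (auto simp: scale_mat_def subset_iff)
    also have "\<dots> = of_real ((\<Prod>i\<in>\<alpha>. s i) * (\<Prod>i\<in>\<alpha>. s (p i))) * (\<Prod>i\<in>\<alpha>. A $$ (i, p i))"
      by (simp add: prod.distrib)
    also have "(\<Prod>i\<in>\<alpha>. s (p i)) = (\<Prod>i\<in>\<alpha>. s i)"
      using prod.permute[OF p, of s] by (simp add: o_def)
    finally show ?thesis by (simp add: prod.distrib power2_eq_square)
  qed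
  then show ?thesis
    by (simp add: pminor_def sum_distrib_left mult_ac)
qed

text \<open>Write \<open>N = z I + A\<close> and let \<open>v\<close> be column \<open>l\<close> of the adjugate of \<open>N\<close>, so that \<open>N v = det N e\<^sub>l\<close>.
Erasing row and column \<open>l\<close> of \<open>A\<close> turns the determinant into \<open>z v\<^sub>l\<close>, and the imaginary part of
\<open>v\<^sup>* N v = cnj v\<^sub>l det N\<close> is \<open>\<epsilon>\<close> times the squared norm of \<open>v\<close>, hence at least \<open>\<epsilon>\<close> times the square of
\<open>cmod v\<^sub>l\<close>. This is the bound \<open>1 / \<epsilon>\<close> for a diagonal entry of the resolvent.\<close>

lemma det_shift_erase_le:
  assumes A: "A \<in> carrier_mat n n" "hermitian_mat A" and l: "l < n" and \<epsilon>: "\<epsilon> > 0"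
  defines "z \<equiv> \<i> * of_real \<epsilon>"
  shows "cmod (det (z \<cdot>\<^sub>m 1\<^sub>m n + scale_mat (\<lambda>i. of_bool (i \<noteq> l)) A)) \<le> cmod (det (z \<cdot>\<^sub>m 1\<^sub>m n + A))"
proof -
  let ?N = "z \<cdot>\<^sub>m 1\<^sub>m n + A"
  let ?N' = "z \<cdot>\<^sub>m 1\<^sub>m n + scale_mat (\<lambda>i. of_bool (i \<noteq> l)) A"
  have N: "?N \<in> carrier_mat n n" and N': "?N' \<in> carrier_mat n n" using A by simp_all
  define v where "v = col (adj_mat ?N) l"
  have v: "v \<in> carrier_vec n" using col_dim[of "adj_mat ?N" l] adj_mat(1)[OF N] by (simp add: v_def)
  have "v $ l = cofactor ?N l l"
    using l A(1) by (simp add: v_def adj_mat_def)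
  have "mat_delete ?N' l l = mat_delete ?N l l"
    using A(1) by (auto simp: mat_delete_def scale_mat_def intro!: eq_matI)
  then have cof: "cofactor ?N' l l = v $ l"
    using \<open>v $ l = cofactor ?N l l\<close> by (simp add: cofactor_def)
  have "det ?N' = (\<Sum>j<n. ?N' $$ (l, j) * cofactor ?N' l j)"
    by (rule laplace_expansion_row[OF N' l])
  also have "\<dots> = (\<Sum>j<n. if j = l then z * v $ l else 0)"
    using A(1) l cof by (intro sum.cong) (auto simp: scale_mat_def)
  also have "\<dots> = z * v $ l" using l by simp
  finally have det': "cmod (det ?N') = \<epsilon> * cmod (v $ l)"
    using \<epsilon> by (simp add: z_def norm_mult)
  have "?N *\<^sub>v v = col (?N * adj_mat ?N) l"
    unfolding v_def using adj_mat(1)[OF N] l N by (intro eq_vecI) auto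
  also have "\<dots> = col (det ?N \<cdot>\<^sub>m 1\<^sub>m n) l" by (simp add: adj_mat(2)[OF N])
  finally have Nv: "(?N *\<^sub>v v) $ i = (if i = l then det ?N else 0)" if "i < n" for i
    using that l by simp
  have "(\<Sum>i<n. cnj (v $ i) * (?N *\<^sub>v v) $ i) = (\<Sum>i<n. if i = l then cnj (v $ l) * det ?N else 0)"
    by (intro sum.cong) (auto simp: Nv)
  also have "\<dots> = cnj (v $ l) * det ?N" using l by simp
  finally have "Im (cnj (v $ l) * det ?N) = \<epsilon> * (\<Sum>i<n. (cmod (v $ i))\<^sup>2)"
    using Im_hermitian_form_shifted[OF A v, of z] by (simp add: z_def)
  moreover have "Im (cnj (v $ l) * det ?N) \<le> cmod (v $ l) * cmod (det ?N)"
    by (metis abs_Im_le_cmod abs_le_D1 complex_mod_cnj norm_mult)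
  moreover have "\<epsilon> * (cmod (v $ l))\<^sup>2 \<le> \<epsilon> * (\<Sum>i<n. (cmod (v $ i))\<^sup>2)"
    using \<epsilon> l by (intro mult_left_mono member_le_sum) auto
  ultimately have "cmod (v $ l) * (\<epsilon> * cmod (v $ l)) \<le> cmod (v $ l) * cmod (det ?N)"
    by (simp add: power2_eq_square mult_ac)
  then have "\<epsilon> * cmod (v $ l) \<le> cmod (det ?N)"
    by (cases "v $ l = 0") auto
  then show ?thesis using det' by simp
qed

lemma det_shift_restrict_le:
  assumes A: "A \<in> carrier_mat n n" "hermitian_mat A" and \<beta>: "\<beta> \<subseteq> {..<n}" and \<epsilon>: "\<epsilon> > 0"
  defines "z \<equiv> \<i> * of_real \<epsilon>"
  shows "cmod (det (z \<cdot>\<^sub>m 1\<^sub>m n + scale_mat (\<lambda>i. of_bool (i \<notin> \<beta>)) A)) \<le> cmod (det (z \<cdot>\<^sub>m 1\<^sub>m n + A))"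
  using finite_subset[OF \<beta> finite_lessThan] \<beta>
proof (induction \<beta> rule: finite_induct)
  case empty
  have "scale_mat (\<lambda>i. of_bool (i \<notin> {})) A = A"
    using A(1) by (auto simp: scale_mat_def intro!: eq_matI)
  then show ?case by simp
next
  case (insert l \<beta>)
  let ?B = "scale_mat (\<lambda>i. of_bool (i \<notin> \<beta>)) A"
  have "scale_mat (\<lambda>i. of_bool (i \<noteq> l)) ?B = scale_mat (\<lambda>i. of_bool (i \<notin> insert l \<beta>)) A"
    using A(1) by (auto simp: scale_mat_def intro!: eq_matI)
  moreover have "cmod (det (z \<cdot>\<^sub>m 1\<^sub>m n + scale_mat (\<lambda>i. of_bool (i \<noteq> l)) ?B)) \<le>
      cmod (det (z \<cdot>\<^sub>m 1\<^sub>m n + ?B))"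
    unfolding z_def using A insert.prems \<epsilon>
    by (intro det_shift_erase_le hermitian_scale_mat) auto
  ultimately show ?case using insert by simp
qed

text \<open>A Hermitian matrix has as many nonzero eigenvalues, counted with multiplicity, as its rank, so if
the characteristic polynomial has a root of order more than \<open>n - card \<alpha>\<close> at 0, then the rank is less than
\<open>card \<alpha>\<close> and the minor on \<open>\<alpha>\<close> vanishes. Instead of diagonalizing, the proof erases all rows and
columns outside \<open>\<alpha>\<close>: by the resolvent bound this does not lower the order of vanishing at 0, and after it
the coefficient at \<open>n - card \<alpha>\<close> is the single minor on \<open>\<alpha>\<close>.\<close>

lemma pminor_eq_0_if_minor_sums_0:
  assumes A: "A \<in> carrier_mat n n" "hermitian_mat A"
    and sums: "\<And>k. card \<alpha> \<le> k \<Longrightarrow> k \<le> n \<Longrightarrow> minor_sum A k = 0"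
    and \<alpha>: "\<alpha> \<subseteq> {..<n}"
  shows "pminor A \<alpha> = 0"
proof -
  let ?k = "card \<alpha>"
  let ?R = "scale_mat (\<lambda>i. of_bool (i \<notin> {..<n} - \<alpha>)) A"
  have k: "?k \<le> n" using card_mono[OF _ \<alpha>] by simp
  have R: "?R \<in> carrier_mat n n" using A by simp
  have "monom 1 (Suc (n - ?k)) dvd shift_poly A"
    unfolding monom_1_dvd_iff'
  proof (intro allI impI)
    fix i assume "i < Suc (n - ?k)"
    then have "i = n - (n - i)" "?k \<le> n - i" using k by auto
    then show "coeff (shift_poly A) i = 0"
      using coeff_shift_poly[OF A(1), of "n - i"] sums[of "n - i"] by simp
  qed
  then have "monom 1 (Suc (n - ?k)) dvd shift_poly ?R"
    using det_shift_restrict_le[OF A, of "{..<n} - \<alpha>"]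
    by (intro monom_dvd_if_norm_le[of "shift_poly ?R" "shift_poly A"])
      (simp_all only: poly_shift_poly[OF A(1)] poly_shift_poly[OF R]
        Diff_subset simp_thms)
  then have "minor_sum ?R ?k = 0"
    using coeff_shift_poly[OF R k] by (simp add: monom_1_dvd_iff')
  moreover have "minor_sum ?R ?k = pminor A \<alpha>"
  proof -
    have fin: "finite {\<beta>. \<beta> \<subseteq> {..<n} \<and> card \<beta> = ?k}"
      by (rule finite_subset[of _ "Pow {..<n}"]) auto
    have "pminor ?R \<beta> = (if \<beta> = \<alpha> then pminor A \<alpha> else 0)" if "\<beta> \<subseteq> {..<n}" "card \<beta> = ?k" for \<beta>
    proof (cases "\<beta> = \<alpha>")
      case True
      then show ?thesis using pminor_scale_mat[OF A(1) \<alpha>] by auto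
    next
      case False
      have "finite \<alpha>" using \<alpha> finite_subset by blast
      then have "\<not> \<beta> \<subseteq> \<alpha>" using False that(2) card_subset_eq by blast
      then have "(\<Prod>i\<in>\<beta>. (of_bool (i \<notin> {..<n} - \<alpha>) :: real)\<^sup>2) = 0"
        using that(1) by (intro prod_zero) (auto intro: finite_subset)
      then show ?thesis
        unfolding pminor_scale_mat[OF A(1) that(1)] using False by (simp only: of_real_0) simp
    qed
    then have "minor_sum ?R ?k =
        (\<Sum>\<beta> | \<beta> \<subseteq> {..<n} \<and> card \<beta> = ?k. if \<beta> = \<alpha> then pminor A \<alpha> else 0)"
      unfolding minor_sum_def using A(1) by (intro sum.cong) (auto simp: scale_mat_def)
    then show ?thesis using fin \<alpha> by simp
  qed
  ultimately show ?thesis by simp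
qed

section \<open>Adjacent orders, one of them without nonzero minors\<close>

lemma pminor_real:
  assumes "A \<in> carrier_mat n n" "hermitian_mat A" "\<alpha> \<subseteq> {..<n}"
  shows "pminor A \<alpha> \<in> \<real>"
  using det_principal_submatrix_real[OF assms(2)] det_submatrix_eq_pminor[OF assms(1,3)] by metis

text \<open>Minor sums are coefficients of \<^term>\<open>shift_poly A\<close> in reversed order, so a vanishing pair spreads to
higher orders.\<close>

lemma adjacent_minor_sums_0:
  assumes A: "A \<in> carrier_mat n n" "hermitian_mat A"
    and zero: "minor_sum A m = 0" "minor_sum A (Suc m) = 0" and m: "Suc m \<le> n" and k: "m \<le> k" "k \<le> n"
  shows "minor_sum A k = 0"
proof -
  have "coeff (shift_poly A) (n - k) = 0"
  proof (rule real_rooted_consecutive_zero_coeffs[of _ "n - Suc m"])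
    show "real_rooted (shift_poly A)" by (rule real_rooted_shift_poly[OF A])
    show "coeff (shift_poly A) (n - Suc m) = 0"
      using coeff_shift_poly[OF A(1) m] zero by simp
    show "coeff (shift_poly A) (Suc (n - Suc m)) = 0"
      using coeff_shift_poly[OF A(1), of m] zero m by (simp add: Suc_diff_Suc)
    show "Suc (n - Suc m) \<le> degree (shift_poly A)" "n - k \<le> Suc (n - Suc m)"
      using degree_shift_poly[OF A(1)] m k by simp_all
  qed
  then show ?thesis using coeff_shift_poly[OF A(1) k(2)] by simp
qed

text \<open>The heart of the matter. The weights \<open>w t\<close> move from the indicator of \<open>\<alpha>\<close> to that of \<open>\<beta>\<close>, and with
\<open>D = diag (sqrt (w t))\<close> the sum of the order-\<open>k\<close> minors of \<open>D B D\<close> moves from the minor on \<open>\<alpha>\<close> to the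
minor on \<open>\<beta>\<close>, so it vanishes for some \<open>t\<close> strictly between 0 and 1. For this \<open>t\<close> the minor sums of the two adjacent
orders \<open>k\<close> and \<open>l\<close> are both 0. Real-rootedness then kills all minor sums of order at least \<open>k\<close>,
hence the minor on \<open>\<alpha>\<close>, although \<open>w t\<close> is positive on \<open>\<alpha>\<close>.\<close>

lemma same_sign_if_adjacent_order_0:
  assumes B: "B \<in> carrier_mat n n" "hermitian_mat B"
    and adj: "l = Suc k \<or> k = Suc l" and l: "l \<le> n"
    and zero: "\<And>\<gamma>. \<gamma> \<subseteq> {..<n} \<Longrightarrow> card \<gamma> = l \<Longrightarrow> pminor B \<gamma> = 0"
    and \<alpha>: "\<alpha> \<subseteq> {..<n}" "card \<alpha> = k" "Re (pminor B \<alpha>) > 0"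
    and \<beta>: "\<beta> \<subseteq> {..<n}" "card \<beta> = k" "Re (pminor B \<beta>) < 0"
  shows False
proof -
  define w :: "real \<Rightarrow> nat \<Rightarrow> real" where
    "w = (\<lambda>t i. (1 - t) * of_bool (i \<in> \<alpha>) + t * of_bool (i \<in> \<beta>))"
  define g where "g = (\<lambda>t. \<Sum>\<gamma> | \<gamma> \<subseteq> {..<n} \<and> card \<gamma> = k. (\<Prod>i\<in>\<gamma>. w t i) * Re (pminor B \<gamma>))"
  have fin: "finite \<gamma>" if "\<gamma> \<subseteq> {..<n}" for \<gamma> using that finite_subset by blast
  have fins: "finite {\<gamma>. \<gamma> \<subseteq> {..<n} \<and> card \<gamma> = k}"
    by (rule finite_subset[of _ "Pow {..<n}"]) auto
  have endpoint: "(\<Sum>\<gamma> | \<gamma> \<subseteq> {..<n} \<and> card \<gamma> = k. (\<Prod>i\<in>\<gamma>. of_bool (i \<in> \<delta>)) * Re (pminor B \<gamma>)) =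
      Re (pminor B \<delta>)" if \<delta>: "\<delta> \<subseteq> {..<n}" "card \<delta> = k" for \<delta>
  proof -
    have "(\<Prod>i\<in>\<gamma>. of_bool (i \<in> \<delta>) :: real) = (if \<gamma> = \<delta> then 1 else 0)"
      if \<gamma>: "\<gamma> \<subseteq> {..<n}" "card \<gamma> = k" for \<gamma>
    proof (cases "\<gamma> = \<delta>")
      case False
      then have "\<not> \<gamma> \<subseteq> \<delta>" using card_subset_eq[OF fin[OF \<delta>(1)]] \<gamma>(2) \<delta>(2) by auto
      then have "(\<Prod>i\<in>\<gamma>. of_bool (i \<in> \<delta>) :: real) = 0"
        using fin[OF \<gamma>(1)] by (intro prod_zero) auto
      then show ?thesis using False by simp
    qed simp
    then have "(\<Sum>\<gamma> | \<gamma> \<subseteq> {..<n} \<and> card \<gamma> = k. (\<Prod>i\<in>\<gamma>. of_bool (i \<in> \<delta>)) * Re (pminor B \<gamma>)) =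
        (\<Sum>\<gamma> | \<gamma> \<subseteq> {..<n} \<and> card \<gamma> = k. if \<gamma> = \<delta> then Re (pminor B \<delta>) else 0)"
      by (intro sum.cong) auto
    then show ?thesis using fins \<delta> by simp
  qed
  have g0: "g 0 > 0" and g1: "g 1 < 0"
    using endpoint[OF \<alpha>(1,2)] endpoint[OF \<beta>(1,2)] \<alpha>(3) \<beta>(3) by (simp_all add: g_def w_def)
  have "\<exists>t\<ge>0. t \<le> 1 \<and> g t = 0"
    using g0 g1 unfolding g_def w_def
    by (intro IVT2') (auto intro!: continuous_intros)
  then obtain t where t: "0 \<le> t" "t \<le> 1" "g t = 0" by blast
  with g0 g1 have t01: "0 < t" "t < 1" by (auto simp: less_le)
  define A where "A = scale_mat (\<lambda>i. sqrt (w t i)) B"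
  have A: "A \<in> carrier_mat n n" "hermitian_mat A"
    unfolding A_def using B hermitian_scale_mat by auto
  have w0: "0 \<le> w t i" for i using t01 by (simp add: w_def)
  have minor: "pminor A \<gamma> = of_real (\<Prod>i\<in>\<gamma>. w t i) * pminor B \<gamma>" if "\<gamma> \<subseteq> {..<n}" for \<gamma>
    unfolding A_def pminor_scale_mat[OF B(1) that] real_sqrt_pow2[OF w0] ..
  have "minor_sum A k = of_real (g t)"
  proof -
    have "pminor A \<gamma> = of_real ((\<Prod>i\<in>\<gamma>. w t i) * Re (pminor B \<gamma>))" if "\<gamma> \<subseteq> {..<n}" for \<gamma>
      using minor[OF that] pminor_real[OF B that] by simp
    then show ?thesis
      using A(1) by (auto simp: minor_sum_def g_def intro!: sum.cong)
  qed
  then have sum_k: "minor_sum A k = 0" using t(3) by simp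
  have sum_l: "minor_sum A l = 0"
    using A(1) minor zero by (auto simp: minor_sum_def intro!: sum.neutral)
  have k: "k \<le> n" using card_mono[OF _ \<alpha>(1)] \<alpha>(2) by simp
  have "minor_sum A i = 0" if "k \<le> i" "i \<le> n" for i
    using adj
  proof
    assume "l = Suc k"
    then show ?thesis
      using adjacent_minor_sums_0[OF A, of k i] sum_k sum_l l that by simp
  next
    assume "k = Suc l"
    then show ?thesis
      using adjacent_minor_sums_0[OF A, of l i] sum_k sum_l k that by simp
  qed
  then have "pminor A \<alpha> = 0"
    using \<alpha>(1,2) by (intro pminor_eq_0_if_minor_sums_0[OF A]) auto
  moreover have "(\<Prod>i\<in>\<alpha>. w t i) > 0"
    using t01 by (intro prod_pos) (auto simp: w_def intro: add_pos_nonneg)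
  ultimately show False using minor[OF \<alpha>(1)] \<alpha>(3) by (simp flip: of_real_prod)
qed

lemma principal_minors_eq:
  assumes "B \<in> carrier_mat n n"
  shows "principal_minors B k = {Re (pminor B \<alpha>) | \<alpha>. \<alpha> \<subseteq> {..<n} \<and> card \<alpha> = k}"
  using assms unfolding principal_minors_def setcompr_eq_image
  by (intro image_cong) (auto simp: det_submatrix_eq_pminor[OF assms])

lemma no_mixed_signs_next_to_N:
  assumes B: "B \<in> carrier_mat n n" "hermitian_mat B"
    and adj: "l = Suc k \<or> k = Suc l" and le: "l \<le> n" "k \<le> n"
    and N: "sepr_term B l = N"
  shows "sepr_term B k \<notin> {A_star, S_star}"
proof
  assume "sepr_term B k \<in> {A_star, S_star}"
  then have "\<exists>m\<in>principal_minors B k. m > 0" "\<exists>m\<in>principal_minors B k. m < 0"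
    using sepr_term_eq_iff[of k B] B(1) le(2) by auto
  then obtain \<alpha> \<beta> where "\<alpha> \<subseteq> {..<n}" "card \<alpha> = k" "Re (pminor B \<alpha>) > 0"
    and "\<beta> \<subseteq> {..<n}" "card \<beta> = k" "Re (pminor B \<beta>) < 0"
    unfolding principal_minors_eq[OF B(1)] by blast
  moreover have "pminor B \<gamma> = 0" if \<gamma>: "\<gamma> \<subseteq> {..<n}" "card \<gamma> = l" for \<gamma>
  proof -
    have "\<forall>m\<in>principal_minors B l. m = 0"
      using sepr_term_eq_iff[of l B N] N B(1) le(1) by auto
    then have "Re (pminor B \<gamma>) = 0"
      using \<gamma> unfolding principal_minors_eq[OF B(1)] by blast
    then show ?thesis
      using pminor_real[OF B \<gamma>(1)] by (simp add: complex_is_Real_iff complex_eq_iff)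
  qed
  ultimately show False
    using same_sign_if_adjacent_order_0[OF B adj le(1)] by blast
qed

lemma sublist_pair_iff:
  "sublist [x, y] zs \<longleftrightarrow> (\<exists>i. Suc i < length zs \<and> zs ! i = x \<and> zs ! Suc i = y)"
proof
  assume "sublist [x, y] zs"
  then obtain ps ss where "zs = ps @ [x, y] @ ss" by (auto simp: sublist_def)
  then show "\<exists>i. Suc i < length zs \<and> zs ! i = x \<and> zs ! Suc i = y"
    by (intro exI[of _ "length ps"]) (simp add: nth_append)
next
  assume "\<exists>i. Suc i < length zs \<and> zs ! i = x \<and> zs ! Suc i = y"
  then obtain i where "Suc i < length zs" "zs ! i = x" "zs ! Suc i = y" by blast
  then have "zs = take i zs @ [x, y] @ drop (Suc (Suc i)) zs"
    by (metis Cons_nth_drop_Suc Suc_lessD append_Cons append_Nil append_take_drop_id)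
  then show "sublist [x, y] zs" unfolding sublist_def by blast
qed

lemma sublist_pair_sepr_iff:
  "sublist [x, y] (sepr B) \<longleftrightarrow>
    (\<exists>k\<ge>1. Suc k \<le> dim_row B \<and> sepr_term B k = x \<and> sepr_term B (Suc k) = y)"
proof -
  have "sepr B ! i = sepr_term B (Suc i)" if "i < dim_row B" for i
    using that by (simp add: sepr_def del: upt_Suc)
  then have "sublist [x, y] (sepr B) \<longleftrightarrow> (\<exists>i. Suc i < dim_row B \<and>
      sepr_term B (Suc i) = x \<and> sepr_term B (Suc (Suc i)) = y)"
    unfolding sublist_pair_iff by auto
  also have "\<dots> \<longleftrightarrow>
      (\<exists>k\<ge>1. Suc k \<le> dim_row B \<and> sepr_term B k = x \<and> sepr_term B (Suc k) = y)"
    by (auto simp: Suc_le_eq gr0_conv_Suc)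
  finally show ?thesis .
qed

section \<open>Witnesses of order 4\<close>

definition det2 :: "(nat \<Rightarrow> nat \<Rightarrow> 'a::comm_ring_1) \<Rightarrow> nat \<Rightarrow> nat \<Rightarrow> 'a" where
  "det2 a i j = a i i * a j j - a i j * a j i"

definition det3 :: "(nat \<Rightarrow> nat \<Rightarrow> 'a::comm_ring_1) \<Rightarrow> nat \<Rightarrow> nat \<Rightarrow> nat \<Rightarrow> 'a" where
  "det3 a i j k = a i i * a j j * a k k + a i j * a j k * a k i + a i k * a j i * a k j
    - a i i * a j k * a k j - a i j * a j i * a k k - a i k * a j j * a k i"

lemma pminor_pair:
  assumes "i \<noteq> j"
  shows "pminor A {i, j} = det2 (\<lambda>i j. A $$ (i, j)) i j"
proof -
  have ij: "finite {j}" "i \<notin> {j}" using assms by auto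
  show ?thesis
    unfolding det2_def pminor_def sum_over_permutations_insert[OF ij] permutes_sing
    using assms by (simp add: sign_swap_id swap_id_eq)
qed

lemma pminor_triple:
  assumes "i \<noteq> j" "i \<noteq> k" "j \<noteq> k"
  shows "pminor A {i, j, k} = det3 (\<lambda>i j. A $$ (i, j)) i j k"
proof -
  have ijk: "finite {j, k}" "i \<notin> {j, k}" and jk: "finite {k}" "j \<notin> {k}" using assms by auto
  show ?thesis
    unfolding det3_def pminor_def sum_over_permutations_insert[OF ijk] sum_over_permutations_insert[OF jk]
      permutes_sing
    using assms
    by (simp add: sign_swap_id permutation_swap_id sign_compose swap_id_eq permutation_compose)
qed

text \<open>The symmetric matrix of size 4 whose list of entries starts with the diagonal and continues with the
entries above the diagonal, row by row.\<close>

definition sym_rows :: "int list \<Rightarrow> int list list" where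
  "sym_rows xs = map (map ((!) xs)) [[0, 4, 5, 6], [4, 1, 7, 8], [5, 7, 2, 9], [6, 8, 9, 3]]"

text \<open>The principal minors of orders 2 and 3 in integer arithmetic, so that the table of witnesses can be
checked by evaluation.\<close>

definition minors2 :: "int list list \<Rightarrow> int list" where
  "minors2 M = [det2 (\<lambda>i j. M ! i ! j) i j. j \<leftarrow> [0..<4], i \<leftarrow> [0..<j]]"

definition minors3 :: "int list list \<Rightarrow> int list" where
  "minors3 M = [det3 (\<lambda>i j. M ! i ! j) i j k. k \<leftarrow> [0..<4], j \<leftarrow> [0..<k], i \<leftarrow> [0..<j]]"

fun has_symbol :: "int list \<Rightarrow> sepr_symbol \<Rightarrow> bool" where
  "has_symbol ms A_star \<longleftrightarrow> (\<forall>m\<in>set ms. m \<noteq> 0) \<and> (\<exists>m\<in>set ms. m > 0) \<and> (\<exists>m\<in>set ms. m < 0)"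
| "has_symbol ms A_plus \<longleftrightarrow> (\<forall>m\<in>set ms. m > 0)"
| "has_symbol ms A_minus \<longleftrightarrow> (\<forall>m\<in>set ms. m < 0)"
| "has_symbol ms N \<longleftrightarrow> (\<forall>m\<in>set ms. m = 0)"
| "has_symbol ms S_star \<longleftrightarrow>
     (\<exists>m\<in>set ms. m > 0) \<and> (\<exists>m\<in>set ms. m < 0) \<and> (\<exists>m\<in>set ms. m = 0)"
| "has_symbol ms S_plus \<longleftrightarrow>
     (\<exists>m\<in>set ms. m = 0) \<and> (\<exists>m\<in>set ms. m \<noteq> 0) \<and> (\<forall>m\<in>set ms. m \<noteq> 0 \<longrightarrow> m > 0)"
| "has_symbol ms S_minus \<longleftrightarrow>
     (\<exists>m\<in>set ms. m = 0) \<and> (\<exists>m\<in>set ms. m \<noteq> 0) \<and> (\<forall>m\<in>set ms. m \<noteq> 0 \<longrightarrow> m < 0)"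

lemma sepr_symbol_of_ints: "sepr_symbol_of (real_of_int ` set ms) s \<longleftrightarrow> has_symbol ms s"
  by (cases s) auto

text \<open>For every admissible pair \<open>(s, t)\<close> a matrix in which \<open>s\<close> and \<open>t\<close> are the terms of orders 2 and 3.
Order 1 would not suffice: a zero diagonal makes the minors of order 2 nonpositive, so for example
\<open>N\<close> followed by \<open>A_plus\<close> first becomes possible at orders 2 and 3.
The entries were found by search.\<close>

definition witnesses :: "(sepr_symbol \<times> sepr_symbol \<times> int list) list" where
  "witnesses =
  [(A_star, A_star, [-1, 1, 1, 1, 0, 0, 0, 0, 0, 0]),
   (A_star, A_plus, [-1, -1, 0, 0, 0, 1, 1, 1, 1, 1]),
   (A_star, A_minus, [0, 0, 1, 1, -1, 1, 1, 1, 1, 0]),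
   (A_star, S_star, [-1, 0, 1, 1, 1, 0, 1, 1, 1, 0]),
   (A_star, S_plus, [-1, -1, 0, 1, 0, 1, 0, 1, 0, 1]),
   (A_star, S_minus, [-1, 0, 1, 1, 1, 0, 0, 1, 1, 0]),
   (A_plus, A_star, [2, 2, 1, 1, -1, 0, 1, 0, 1, 0]),
   (A_plus, A_plus, [1, 1, 1, 1, 0, 0, 0, 0, 0, 0]),
   (A_plus, A_minus, [-1, -1, -1, -1, 0, 0, 0, 0, 0, 0]),
   (A_plus, N, [2, 1, 2, 1, 1, 0, -1, 1, 0, 1]),
   (A_plus, S_star, [1, 2, 1, 2, 1, 0, -1, 0, 1, 1]),
   (A_plus, S_plus, [1, 2, 1, 1, 0, 0, 0, 1, 1, 0]),
   (A_plus, S_minus, [-1, -1, -2, -1, 0, 1, 0, 1, 0, 0]),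
   (A_minus, A_star, [0, 0, 0, 0, -1, 1, 1, 1, 1, 1]),
   (A_minus, A_plus, [0, 0, 0, 0, 1, 1, 1, 1, 1, 1]),
   (A_minus, A_minus, [0, 0, 0, 0, -1, 1, 1, 1, 1, -1]),
   (A_minus, N, [-1, 1, 0, 0, 0, 1, -1, 1, 1, 2]),
   (A_minus, S_star, [-1, 0, 0, 1, -1, 1, 0, 1, 1, 1]),
   (A_minus, S_plus, [-1, 0, 0, 1, 1, 1, 0, 1, 1, 1]),
   (A_minus, S_minus, [-1, 0, 0, 1, 1, 1, 0, -1, 1, 1]),
   (N, A_plus, [-1, -1, -1, -1, 1, 1, 1, 1, 1, 1]),
   (N, A_minus, [1, 1, 1, 1, -1, 1, 1, 1, 1, -1]),
   (N, N, [0, 0, 0, 0, 0, 0, 0, 0, 0, 0]),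
   (N, S_plus, [-1, -1, -1, 0, 1, 1, 0, 1, 0, 0]),
   (N, S_minus, [0, 1, 1, 1, 0, 0, 0, -1, 1, 1]),
   (S_star, A_star, [0, 0, 1, 1, 1, 0, 1, 0, 1, 0]),
   (S_star, A_plus, [-1, -1, 0, 0, 0, 0, 0, 1, 1, 1]),
   (S_star, A_minus, [0, 0, 1, 1, 1, 0, 1, 1, 0, 0]),
   (S_star, S_star, [0, 1, 1, 1, 0, 0, 1, 0, 0, 0]),
   (S_star, S_plus, [-1, -1, 0, 0, 0, 0, 0, 0, 0, 1]),
   (S_star, S_minus, [0, 0, 1, 1, 0, 0, 0, 0, 1, 0]),
   (S_plus, A_star, [1, 1, 1, 1, 0, 0, 1, 0, 1, 1]),
   (S_plus, A_plus, [-1, -1, -1, -1, 0, 1, 1, 1, 1, 0]),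
   (S_plus, A_minus, [1, 1, 1, 1, 0, 1, 1, 1, 1, 0]),
   (S_plus, N, [0, 0, 1, 1, 0, 0, 0, 0, 0, 0]),
   (S_plus, S_star, [1, 1, 1, 1, 0, 0, 0, 0, 1, 1]),
   (S_plus, S_plus, [0, 1, 1, 1, 0, 0, 0, 0, 0, 0]),
   (S_plus, S_minus, [-1, -1, -1, 0, 0, 0, 0, 0, 0, 0]),
   (S_minus, A_star, [0, 0, 0, 1, 1, 1, 0, 1, 0, 0]),
   (S_minus, A_plus, [-1, 0, 0, 0, 0, 0, 0, 1, 1, 1]),
   (S_minus, A_minus, [0, 0, 0, 1, -1, 1, 0, 1, 0, 0]),
   (S_minus, N, [0, 0, 0, 0, 0, 0, 0, 0, 0, 1]),
   (S_minus, S_star, [-1, 0, 0, 1, 0, 0, 0, 1, 0, 0]),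
   (S_minus, S_plus, [-1, 0, 0, 0, 0, 0, 0, 0, 0, 1]),
   (S_minus, S_minus, [0, 0, 0, 1, 0, 0, 0, 1, 0, 0])]"

lemma witnesses_valid:
  "\<forall>(s, t, xs)\<in>set witnesses. has_symbol (minors2 (sym_rows xs)) s \<and> has_symbol (minors3 (sym_rows xs)) t"
  by code_simp

lemma witnesses_complete:
  assumes "[s, t] \<notin> {[A_star, N], [N, A_star], [N, S_star], [S_star, N]}"
  shows "\<exists>xs. (s, t, xs) \<in> set witnesses"
  using assms by (cases s; cases t) (simp_all add: witnesses_def)

lemma subsets_card_2:
  "{\<alpha>. \<alpha> \<subseteq> {..<n::nat} \<and> card \<alpha> = 2} = {{i, j} | i j. i < j \<and> j < n}"
proof (intro subset_antisym subsetI)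
  fix \<alpha> assume "\<alpha> \<in> {\<alpha>. \<alpha> \<subseteq> {..<n} \<and> card \<alpha> = 2}"
  then have \<alpha>: "finite \<alpha>" "\<alpha> \<subseteq> {..<n}" "card \<alpha> = 2"
    by (auto intro: finite_subset)
  define l where "l = sorted_list_of_set \<alpha>"
  have l: "set l = \<alpha>" "sorted_wrt (<) l" "length l = 2"
    using \<alpha> by (simp_all add: l_def)
  from l(3) obtain i j where "l = [i, j]"
    by (auto simp: numeral_2_eq_2 length_Suc_conv)
  with l(1,2) \<alpha>(2) show "\<alpha> \<in> {{i, j} | i j. i < j \<and> j < n}" by auto
qed auto

lemma subsets_card_3:
  "{\<alpha>. \<alpha> \<subseteq> {..<n::nat} \<and> card \<alpha> = 3} = {{i, j, k} | i j k. i < j \<and> j < k \<and> k < n}"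
proof (intro subset_antisym subsetI)
  fix \<alpha> assume "\<alpha> \<in> {\<alpha>. \<alpha> \<subseteq> {..<n} \<and> card \<alpha> = 3}"
  then have \<alpha>: "finite \<alpha>" "\<alpha> \<subseteq> {..<n}" "card \<alpha> = 3"
    by (auto intro: finite_subset)
  define l where "l = sorted_list_of_set \<alpha>"
  have l: "set l = \<alpha>" "sorted_wrt (<) l" "length l = 3"
    using \<alpha> by (simp_all add: l_def)
  from l(3) obtain i j k where "l = [i, j, k]"
    by (auto simp: numeral_3_eq_3 length_Suc_conv)
  with l(1,2) \<alpha>(2) show "\<alpha> \<in> {{i, j, k} | i j k. i < j \<and> j < k \<and> k < n}" by auto
qed auto

definition witness_mat :: "int list \<Rightarrow> complex mat" where
  "witness_mat xs = mat 4 4 (\<lambda>(i, j). of_int (sym_rows xs ! i ! j))"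

lemma less_4_cases: "(i::nat) < 4 \<longleftrightarrow> i = 0 \<or> i = 1 \<or> i = 2 \<or> i = 3"
  by auto

lemma hermitian_witness_mat: "hermitian_mat (witness_mat xs)"
  by (rule hermitian_matI[of _ 4]) (auto simp: witness_mat_def sym_rows_def less_4_cases)

lemma principal_minors_witness_mat:
  "principal_minors (witness_mat xs) 2 = real_of_int ` set (minors2 (sym_rows xs))"
  "principal_minors (witness_mat xs) 3 = real_of_int ` set (minors3 (sym_rows xs))"
proof -
  let ?W = "witness_mat xs" and ?M = "sym_rows xs"
  have car: "?W \<in> carrier_mat 4 4" by (simp add: witness_mat_def)
  have W: "?W $$ (i, j) = of_int (?M ! i ! j)" if "i < 4" "j < 4" for i j
    using that by (simp add: witness_mat_def)
  have eq: "principal_minors ?W k = (\<lambda>\<alpha>. Re (pminor ?W \<alpha>)) ` {\<alpha>. \<alpha> \<subseteq> {..<4} \<and> card \<alpha> = k}" for k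
    unfolding principal_minors_eq[OF car] by (rule setcompr_eq_image)
  have 2: "Re (pminor ?W {i, j}) = of_int (det2 (\<lambda>i j. ?M ! i ! j) i j)" if "i < j" "j < 4" for i j
    using that by (simp add: pminor_pair W det2_def)
  have 3: "Re (pminor ?W {i, j, k}) = of_int (det3 (\<lambda>i j. ?M ! i ! j) i j k)"
    if "i < j" "j < k" "k < 4" for i j k
    using that by (simp add: pminor_triple W det3_def)
  have "x \<in> set (minors2 ?M) \<longleftrightarrow> (\<exists>j<4. \<exists>i<j. x = det2 (\<lambda>i j. ?M ! i ! j) i j)" for x
    unfolding minors2_def set_concat set_map set_upt by fastforce
  then have "set (minors2 ?M) = {det2 (\<lambda>i j. ?M ! i ! j) i j | i j. i < j \<and> j < 4}"
    by blast
  then show "principal_minors ?W 2 = real_of_int ` set (minors2 ?M)"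
    unfolding eq subsets_card_2 by (auto simp: image_iff) (metis 2)+
  have "x \<in> set (minors3 ?M) \<longleftrightarrow>
      (\<exists>k<4. \<exists>j<k. \<exists>i<j. x = det3 (\<lambda>i j. ?M ! i ! j) i j k)" for x
    unfolding minors3_def set_concat set_map set_upt by fastforce
  then have "set (minors3 ?M) =
      {det3 (\<lambda>i j. ?M ! i ! j) i j k | i j k. i < j \<and> j < k \<and> k < 4}"
    by blast
  then show "principal_minors ?W 3 = real_of_int ` set (minors3 ?M)"
    unfolding eq subsets_card_3 by (auto simp: image_iff) (metis 3)+
qed

section \<open>The order-2 sequences that do not occur\<close>

theorem theorem4p2:
  fixes xs :: "sepr_symbol list"
  assumes "length xs = 2"
  shows "(\<not> (\<exists>(n::nat) (B::complex mat).
              n \<ge> 1 \<and> B \<in> carrier_mat n n \<and> hermitian_mat B \<and> sublist xs (sepr B)))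
         \<longleftrightarrow> xs \<in> {[A_star, N], [N, A_star], [N, S_star], [S_star, N]}"
proof -
  obtain s t where xs: "xs = [s, t]"
    using assms by (auto simp: numeral_2_eq_2 length_Suc_conv)
  show ?thesis
  proof
    assume none: "\<not> (\<exists>(n::nat) (B::complex mat).
      n \<ge> 1 \<and> B \<in> carrier_mat n n \<and> hermitian_mat B \<and> sublist xs (sepr B))"
    show "xs \<in> {[A_star, N], [N, A_star], [N, S_star], [S_star, N]}"
    proof (rule ccontr)
      assume "xs \<notin> {[A_star, N], [N, A_star], [N, S_star], [S_star, N]}"
      then obtain ys where "(s, t, ys) \<in> set witnesses"
        using witnesses_complete unfolding xs by blast
      then have "has_symbol (minors2 (sym_rows ys)) s" "has_symbol (minors3 (sym_rows ys)) t"
        using witnesses_valid by auto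
      moreover have car: "witness_mat ys \<in> carrier_mat 4 4" by (simp add: witness_mat_def)
      ultimately have "sepr_term (witness_mat ys) 2 = s" "sepr_term (witness_mat ys) 3 = t"
        by (auto simp: sepr_term_eq_iff principal_minors_witness_mat sepr_symbol_of_ints)
      then have "sublist xs (sepr (witness_mat ys))"
        using car unfolding xs sublist_pair_sepr_iff by (intro exI[of _ 2]) auto
      moreover have "(4::nat) \<ge> 1" by simp
      ultimately show False
        using none car hermitian_witness_mat by blast
    qed
  next
    assume "xs \<in> {[A_star, N], [N, A_star], [N, S_star], [S_star, N]}"
    then have N: "s = N \<and> t \<in> {A_star, S_star} \<or> t = N \<and> s \<in> {A_star, S_star}"
      by (auto simp: xs)
    show "\<not> (\<exists>(n::nat) (B::complex mat).
      n \<ge> 1 \<and> B \<in> carrier_mat n n \<and> hermitian_mat B \<and> sublist xs (sepr B))"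
    proof
      assume "\<exists>(n::nat) (B::complex mat).
        n \<ge> 1 \<and> B \<in> carrier_mat n n \<and> hermitian_mat B \<and> sublist xs (sepr B)"
      then obtain n B k where B: "B \<in> carrier_mat n n" "hermitian_mat B" and k: "Suc k \<le> n"
        and st: "sepr_term B k = s" "sepr_term B (Suc k) = t"
        unfolding xs sublist_pair_sepr_iff by auto
      show False
        using N no_mixed_signs_next_to_N[OF B, of k "Suc k"] no_mixed_signs_next_to_N[OF B, of "Suc k" k]
          k st by auto
    qed
  qed
qed

end
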